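(* Let $X\in\mathbb{R}^{m\times n}$ have full row rank, let $Y\in\mathbb{R}^{k\times n}$, and assume that all the singular values of $YX^{+}X$ are distinct. Let $r>1$ be an integer with $r\le\min(k,m)$, let $\mathcal{M}_{r}$ be the manifold of real $k\times m$ matrices of rank $r$, and let $F_0(W)=\tfrac12\|WX-Y\|_F^2$. Then the reduced rank regression solution $W_r^{(\mathrm{RRR})}=[YX^{+}X]_rX^{+}$ is the only strict local minimum of the problem of minimizing $F_0(W)$ subject to $W\in\mathcal{M}_r$.
   Context: $X^{+}$ denotes the Moore--Penrose pseudo-inverse of $X$. For a matrix $A$, $[A]_r$ denotes the matrix obtained by truncating the singular value decomposition of $A$ to its first (largest) $r$ components. A strict local minimum of the problem is a point $W_*\in\mathcal{M}_r$ having a neighborhood $U$ in $\mathcal{M}_r$ (in the topology induced from $\mathbb{R}^{k\times m}$) with $F_0(W_* )<F_0(W)$ for all $W\in U\setminus\{W_*\}$.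
   Formalization: The formal theorem additionally assumes r ≤ rank(YX⁺X); without this the reduced rank regression solution has rank less than r, so it is not in M_r and the claim fails (e.g. X = I, Y = diag(1,0), r = 2). *)

theory Defs
  imports "HOL-Analysis.Analysis"
begin

text \<open>The four Penrose equations; they have exactly one solution for every real matrix.\<close>

definition is_moore_penrose :: "real^'n^'m \<Rightarrow> real^'m^'n \<Rightarrow> bool" where
  "is_moore_penrose X P \<longleftrightarrow>
     X ** P ** X = X \<and> P ** X ** P = P \<and>
     transpose (X ** P) = X ** P \<and> transpose (P ** X) = P ** X"

definition pinv :: "real^'n^'m \<Rightarrow> real^'m^'n" where
  "pinv X = (THE P. is_moore_penrose X P)"

definition outer_product :: "real^'k \<Rightarrow> real^'n \<Rightarrow> real^'n^'k" where
  "outer_product u v = (\<chi> i j. u $ i * v $ j)"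

definition svd_partial_sum ::
    "nat \<Rightarrow> real list \<Rightarrow> (nat \<Rightarrow> real^'k) \<Rightarrow> (nat \<Rightarrow> real^'n) \<Rightarrow> real^'n^'k" where
  "svd_partial_sum r s u v = (\<Sum>l<r. (s ! l) *\<^sub>R outer_product (u l) (v l))"

definition orthonormal_upto :: "nat \<Rightarrow> (nat \<Rightarrow> real^'n) \<Rightarrow> bool" where
  "orthonormal_upto q u \<longleftrightarrow> (\<forall>i<q. \<forall>j<q. u i \<bullet> u j = (if i = j then 1 else 0))"

text \<open>Compact singular value decomposition: \<open>s\<close> lists the positive singular values with
  multiplicity, in decreasing order, so its length is the rank of \<open>A\<close>. Only the vectors
  \<open>u l\<close> and \<open>v l\<close> with \<open>l < length s\<close> matter.\<close>

definition is_svd ::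
    "real^'n^'k \<Rightarrow> real list \<Rightarrow> (nat \<Rightarrow> real^'k) \<Rightarrow> (nat \<Rightarrow> real^'n) \<Rightarrow> bool" where
  "is_svd A s u v \<longleftrightarrow>
     sorted_wrt (\<ge>) s \<and> (\<forall>x\<in>set s. 0 < x) \<and>
     orthonormal_upto (length s) u \<and> orthonormal_upto (length s) v \<and>
     A = svd_partial_sum (length s) s u v"

text \<open>Every real matrix has a compact singular value decomposition, and its list of singular
  values is unique, so the choice operator below makes no actual choice.\<close>

definition singular_values :: "real^'n^'k \<Rightarrow> real list" where
  "singular_values A = (SOME s. \<exists>u v. is_svd A s u v)"

text \<open>Independent of the chosen singular vectors when the singular values are distinct; equal to
  \<open>A\<close> itself if \<open>A\<close> has fewer than \<open>r\<close> components.\<close>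

definition svd_truncation :: "nat \<Rightarrow> real^'n^'k \<Rightarrow> real^'n^'k" where
  "svd_truncation r A =
     (SOME B. \<exists>u v. is_svd A (singular_values A) u v \<and>
        B = svd_partial_sum (min r (length (singular_values A))) (singular_values A) u v)"

definition rank_manifold :: "nat \<Rightarrow> (real^'m^'k) set" where
  "rank_manifold r = {W. rank W = r}"

text \<open>The norm on \<open>real^'n^'k\<close> is the Frobenius norm.\<close>

definition F0 :: "real^'n^'m \<Rightarrow> real^'n^'k \<Rightarrow> real^'m^'k \<Rightarrow> real" where
  "F0 X Y W = 1/2 * (norm (W ** X - Y))\<^sup>2"

definition rrr_solution :: "nat \<Rightarrow> real^'n^'m \<Rightarrow> real^'n^'k \<Rightarrow> real^'m^'k" where
  "rrr_solution r X Y = svd_truncation r (Y ** pinv X ** X) ** pinv X"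

definition strict_local_min_on ::
    "'a::topological_space set \<Rightarrow> ('a \<Rightarrow> real) \<Rightarrow> 'a \<Rightarrow> bool" where
  "strict_local_min_on S f w \<longleftrightarrow>
     w \<in> S \<and> (\<exists>U. openin (top_of_set S) U \<and> w \<in> U \<and> (\<forall>z\<in>U - {w}. f w < f z))"

end

theory Submission
  imports Defs
begin

text \<open>Write \<open>P\<close> for the pseudo-inverse of \<open>X\<close> and \<open>A = Y ** P ** X\<close>. Since \<open>X ** P = mat 1\<close>, the map
  \<open>W \<mapsto> W ** X\<close> identifies the problem with approximating \<open>A\<close> in the Frobenius norm by rank-\<open>r\<close>
  matrices \<open>B\<close> with \<open>B ** P ** X = B\<close>. The truncated decomposition is the unique global minimizer
  (Eckart--Young). Conversely, at a local minimizer \<open>B\<close> the first-order conditions along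
  \<open>(mat 1 - t M) ** B\<close> and \<open>B ** (mat 1 - t N)\<close> make the residual \<open>A - B\<close> orthogonal to \<open>B\<close> on both
  sides, so decompositions of \<open>B\<close> and \<open>A - B\<close> combine to one of \<open>A\<close>. Strict minimality along rotations
  of singular pairs then forces the singular values of \<open>B\<close> to exceed those of \<open>A - B\<close>, so \<open>B\<close> is
  itself a truncation of \<open>A\<close> with a gap, and Eckart--Young uniqueness identifies it with the
  truncation used in the definition.\<close>

section \<open>Singular value decomposition\<close>

lemma outer_product_mult_vec: "outer_product u v *v x = (v \<bullet> x) *\<^sub>R u"
  by (simp add: vec_eq_iff outer_product_def matrix_vector_mult_def inner_vec_def
      sum_distrib_left sum_distrib_right mult_ac)

lemma vec_mult_outer_product: "x v* outer_product u v = (u \<bullet> x) *\<^sub>R v"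
  by (simp add: vec_eq_iff outer_product_def vector_matrix_mult_def inner_vec_def
      sum_distrib_left sum_distrib_right mult_ac)

lemma inner_outer_product: "A \<bullet> outer_product u v = u \<bullet> (A *v v)"
  by (simp add: outer_product_def matrix_vector_mult_def inner_vec_def
      sum_distrib_left mult_ac)

lemma outer_product_matrix_mult: "outer_product u v ** M = outer_product u (v v* M)"
  by (simp add: vec_eq_iff outer_product_def vector_matrix_mult_def matrix_matrix_mult_def
      sum_distrib_left mult_ac)

lemma matrix_eqI:
  assumes "\<And>x. A *v x = B *v x" shows "A = (B :: real^'n^'m)"
  using assms by (simp add: matrix_eq)

lemma sum_matrix_vector_mult: "(\<Sum>i\<in>I. M i) *v x = (\<Sum>i\<in>I. M i *v (x :: real^'n))"
  by (induction I rule: infinite_finite_induct) (simp_all add: matrix_vector_mult_add_rdistrib)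

lemma sum_matrix_matrix_mult:
  "(\<Sum>i\<in>I. M i) ** N = (\<Sum>i\<in>I. M i ** (N :: real^'p^'n))"
  by (rule matrix_eqI) (simp add: matrix_vector_mul_assoc[symmetric] sum_matrix_vector_mult)

lemma scaleR_matrix_matrix_mult: "(c *\<^sub>R M) ** N = c *\<^sub>R (M ** (N :: real^'p^'n))"
  by (rule matrix_eqI) (simp add: matrix_vector_mul_assoc[symmetric] scaleR_matrix_vector_assoc[symmetric])

lemma diff_matrix_mult: "(A - B) ** (C :: real^'p^'n) = A ** C - B ** C"
  by (rule matrix_eqI) (simp add: matrix_vector_mul_assoc[symmetric] matrix_vector_mult_diff_rdistrib)

text \<open>For the Frobenius inner product, multiplication by \<open>transpose B\<close> is adjoint
  to multiplication by \<open>B\<close>. This is what later turns a first-order condition in a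
  well-chosen direction into the squared norm of a matrix.\<close>

lemma inner_mult_right_transpose:
  fixes A :: "real^'n^'m" and B :: "real^'p^'n" and C :: "real^'p^'m"
  shows "(A ** B) \<bullet> C = A \<bullet> (C ** transpose B)"
proof -
  have "(A ** B) \<bullet> C = (\<Sum>i\<in>UNIV. \<Sum>j\<in>UNIV. \<Sum>k\<in>UNIV. A$i$k * B$k$j * C$i$j)"
    by (simp add: inner_vec_def matrix_matrix_mult_def sum_distrib_right)
  also have "\<dots> = (\<Sum>i\<in>UNIV. \<Sum>k\<in>UNIV. \<Sum>j\<in>UNIV. A$i$k * B$k$j * C$i$j)"
    by (rule sum.cong[OF refl], rule sum.swap)
  also have "\<dots> = A \<bullet> (C ** transpose B)"
    by (simp add: inner_vec_def matrix_matrix_mult_def sum_distrib_left transpose_def mult_ac)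
  finally show ?thesis .
qed

lemma inner_transpose: "transpose A \<bullet> transpose B = A \<bullet> (B :: real^'n^'m)"
  unfolding inner_vec_def transpose_def by simp (rule sum.swap)

lemma inner_mult_left_transpose:
  fixes A :: "real^'n^'m" and B :: "real^'p^'n" and C :: "real^'p^'m"
  shows "(A ** B) \<bullet> C = B \<bullet> (transpose A ** C)"
proof -
  have "(A ** B) \<bullet> C = (transpose B ** transpose A) \<bullet> transpose C"
    by (simp add: inner_transpose flip: matrix_transpose_mul)
  also have "\<dots> = transpose B \<bullet> transpose (transpose A ** C)"
    by (simp add: inner_mult_right_transpose matrix_transpose_mul transpose_transpose)
  finally show ?thesis by (simp add: inner_transpose)
qed

section \<open>Partial sums of singular components\<close>

lemma svd_partial_sum_mult_vec:
  "svd_partial_sum q s u v *v x = (\<Sum>l<q. (s ! l * (v l \<bullet> x)) *\<^sub>R u l)"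
  by (simp add: svd_partial_sum_def sum_matrix_vector_mult outer_product_mult_vec
      flip: scaleR_matrix_vector_assoc)

lemma svd_partial_sum_mult_matrix:
  "svd_partial_sum q s u v ** M = svd_partial_sum q s u (\<lambda>l. v l v* M)"
  by (simp add: svd_partial_sum_def sum_matrix_matrix_mult scaleR_matrix_matrix_mult
      outer_product_matrix_mult)

lemma inner_svd_partial_sum:
  "A \<bullet> svd_partial_sum q s u v = (\<Sum>l<q. s ! l * (u l \<bullet> (A *v v l)))"
  by (simp add: svd_partial_sum_def inner_sum_right inner_outer_product)

lemma vec_mult_svd_partial_sum:
  "x v* svd_partial_sum q s u v = (\<Sum>l<q. (s ! l * (u l \<bullet> x)) *\<^sub>R v l)"
proof -
  have "x v* (\<Sum>l\<in>I. M l) = (\<Sum>l\<in>I. x v* M l)" for I :: "nat set" and M :: "nat \<Rightarrow> real^'a^'b"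
    by (induction I rule: infinite_finite_induct) (simp_all add: vector_matrix_mult_add_rdistrib)
  then show ?thesis
    by (simp add: svd_partial_sum_def vec_mult_outer_product vector_scaleR_matrix_ac)
qed

lemma svd_partial_sum_cong:
  assumes "\<And>l. l < q \<Longrightarrow> s ! l = s' ! l \<and> u l = u' l \<and> v l = v' l"
  shows "svd_partial_sum q s u v = svd_partial_sum q s' u' v'"
  unfolding svd_partial_sum_def using assms by (intro sum.cong) auto

lemma orthonormal_uptoD:
  assumes "orthonormal_upto q u" "i < q" "j < q"
  shows "u i \<bullet> u j = (if i = j then 1 else 0)"
  using assms by (auto simp: orthonormal_upto_def)

lemma svd_partial_sum_right_vector:
  assumes "orthonormal_upto q v" "l < q"
  shows "svd_partial_sum q s u v *v v l = s ! l *\<^sub>R u l"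
proof -
  have "svd_partial_sum q s u v *v v l = (\<Sum>i<q. if i = l then s ! l *\<^sub>R u l else 0)"
    unfolding svd_partial_sum_mult_vec using assms
    by (intro sum.cong) (auto simp: orthonormal_uptoD)
  then show ?thesis using assms by simp
qed

lemma svd_partial_sum_left_vector:
  assumes "orthonormal_upto q u" "l < q"
  shows "u l v* svd_partial_sum q s u v = s ! l *\<^sub>R v l"
proof -
  have "u l v* svd_partial_sum q s u v = (\<Sum>i<q. if i = l then s ! l *\<^sub>R v l else 0)"
    unfolding vec_mult_svd_partial_sum using assms
    by (intro sum.cong) (auto simp: orthonormal_uptoD)
  then show ?thesis using assms by simp
qed

lemma svd_partial_sum_norm:
  assumes "orthonormal_upto q u" "orthonormal_upto q v"
  shows "(norm (svd_partial_sum q s u v))\<^sup>2 = (\<Sum>l<q. (s ! l)\<^sup>2)"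
  unfolding power2_norm_eq_inner inner_svd_partial_sum using assms
  by (intro sum.cong) (auto simp: svd_partial_sum_right_vector orthonormal_uptoD power2_eq_square)

text \<open>The range is exactly the span of the orthonormal vectors \<open>u l\<close>: it is
  contained in that span, and each \<open>u l\<close> is the image of \<open>v l\<close> divided by
  its positive weight.\<close>

lemma rank_svd_partial_sum:
  assumes u: "orthonormal_upto q u" and v: "orthonormal_upto q v" and s: "\<And>l. l < q \<Longrightarrow> 0 < s ! l"
  shows "rank (svd_partial_sum q s u v) = q"
proof -
  let ?A = "svd_partial_sum q s u v" and ?S = "u ` {..<q}"
  have inj: "inj_on u {..<q}"
    by (rule inj_onI) (metis lessThan_iff orthonormal_uptoD[OF u] zero_neq_one)
  have "independent ?S"
  proof (rule pairwise_orthogonal_independent)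
    show "pairwise orthogonal ?S"
      using orthonormal_uptoD[OF u] by (auto simp: pairwise_def orthogonal_def)
    show "0 \<notin> ?S"
      using orthonormal_uptoD[OF u] by (metis imageE inner_zero_left lessThan_iff zero_neq_one)
  qed
  then have dim: "dim ?S = q"
    using inj by (simp add: dim_eq_card_independent card_image)
  have "range ((*v) ?A) \<subseteq> span ?S"
    unfolding svd_partial_sum_mult_vec by (blast intro: span_sum span_scale span_base)
  then have le: "dim (range ((*v) ?A)) \<le> q"
    using dim dim_subset dim_span by metis
  have "u l = ?A *v ((1 / s ! l) *\<^sub>R v l)" if "l < q" for l
    using svd_partial_sum_right_vector[OF v that, of s u] s[OF that]
    by (simp add: matrix_vector_mult_scaleR)
  then have "?S \<subseteq> range ((*v) ?A)" by blast
  from dim_subset[OF this] le dim show ?thesis by (simp add: rank_dim_range)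
qed

lemma is_svd_rank: "is_svd A s u v \<Longrightarrow> rank A = length s"
  unfolding is_svd_def using rank_svd_partial_sum[of "length s" u v s] by (metis nth_mem)

lemma is_svdD:
  assumes "is_svd A s u v"
  shows "orthonormal_upto (length s) u" "orthonormal_upto (length s) v"
    "A = svd_partial_sum (length s) s u v" "\<And>l. l < length s \<Longrightarrow> 0 < s ! l"
    "\<And>i j. i < j \<Longrightarrow> j < length s \<Longrightarrow> s ! j \<le> s ! i"
    "\<And>l. l < length s \<Longrightarrow> A *v v l = s ! l *\<^sub>R u l"
    "\<And>l. l < length s \<Longrightarrow> u l v* A = s ! l *\<^sub>R v l"
proof -
  show u: "orthonormal_upto (length s) u" and v: "orthonormal_upto (length s) v"
    and A: "A = svd_partial_sum (length s) s u v"
    using assms by (simp_all add: is_svd_def)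
  show "\<And>l. l < length s \<Longrightarrow> 0 < s ! l" "\<And>i j. i < j \<Longrightarrow> j < length s \<Longrightarrow> s ! j \<le> s ! i"
    using assms by (simp_all add: is_svd_def sorted_wrt_iff_nth_less)
  show "\<And>l. l < length s \<Longrightarrow> A *v v l = s ! l *\<^sub>R u l"
    "\<And>l. l < length s \<Longrightarrow> u l v* A = s ! l *\<^sub>R v l"
    unfolding A using u v by (simp_all add: svd_partial_sum_right_vector svd_partial_sum_left_vector)
qed

text \<open>The right singular vector is a maximizer of \<open>norm (A *v x)\<close> on the compact
  unit sphere, and \<open>\<sigma>\<close> is the maximum. The bound in the conclusion later keeps
  the list of singular values decreasing.\<close>

lemma exists_top_singular_pair:
  fixes A :: "real^'n^'m"
  assumes "A \<noteq> 0"
  obtains \<sigma> u v where "0 < \<sigma>" "u \<bullet> u = 1" "v \<bullet> v = 1" "A *v v = \<sigma> *\<^sub>R u" "u v* A = \<sigma> *\<^sub>R v"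
    "\<And>x. norm (A *v x) \<le> \<sigma> * norm x"
proof -
  have "compact (sphere (0 :: real^'n) 1)" "sphere (0 :: real^'n) 1 \<noteq> {}" by auto
  moreover have "continuous_on (sphere 0 1) (\<lambda>x. norm (A *v x))"
    by (intro continuous_intros linear_continuous_on matrix_vector_mul_bounded_linear)
  ultimately obtain v where v: "norm v = 1"
    and max: "\<And>x. norm x = 1 \<Longrightarrow> norm (A *v x) \<le> norm (A *v v)"
    using continuous_attains_sup[of "sphere 0 1" "\<lambda>x. norm (A *v x)"] by (auto simp: dist_norm)
  define \<sigma> where "\<sigma> = norm (A *v v)"
  have bound: "norm (A *v x) \<le> \<sigma> * norm x" for x
  proof (cases "x = 0")
    case False
    have "norm (A *v ((1 / norm x) *\<^sub>R x)) \<le> \<sigma>"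
      unfolding \<sigma>_def using False by (intro max) simp
    then show ?thesis using False by (simp add: matrix_vector_mult_scaleR field_simps)
  qed simp
  have "\<sigma> > 0"
  proof (rule ccontr)
    assume "\<not> \<sigma> > 0"
    then have "\<sigma> = 0" by (simp add: \<sigma>_def)
    then have "A *v x = 0" for x using bound[of x] by simp
    then have "A = 0" by (intro matrix_eqI) simp
    with assms show False by simp
  qed
  define u where "u = (1 / \<sigma>) *\<^sub>R (A *v v)"
  have Av: "A *v v = \<sigma> *\<^sub>R u" using \<open>\<sigma> > 0\<close> by (simp add: u_def)
  have nu: "norm u = 1" using \<open>\<sigma> > 0\<close> by (simp add: u_def \<sigma>_def)
  \<comment> \<open>The equation \<open>?w = \<sigma> *\<^sub>R v\<close> comes from the equality
    case of Cauchy-Schwarz: \<open>?w\<close> has norm at most \<open>\<sigma>\<close>, while its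
    inner product with the unit vector \<open>v\<close> is exactly \<open>\<sigma>\<close>.\<close>
  let ?w = "u v* A"
  have "?w \<bullet> ?w = u \<bullet> (A *v ?w)" by (rule dot_lmul_matrix)
  also have "\<dots> \<le> norm u * norm (A *v ?w)" by (rule norm_cauchy_schwarz)
  also have "\<dots> \<le> \<sigma> * norm ?w" using bound[of ?w] nu by simp
  finally have "norm ?w * norm ?w \<le> \<sigma> * norm ?w"
    by (simp add: dot_square_norm power2_eq_square)
  then have "norm ?w \<le> \<sigma>" using \<open>\<sigma> > 0\<close> by (metis mult_le_cancel_right norm_ge_zero norm_zero less_eq_real_def not_less)
  then have "?w \<bullet> ?w \<le> \<sigma>\<^sup>2" by (simp add: dot_square_norm power_mono)
  moreover have "?w \<bullet> v = \<sigma>" using nu by (simp add: dot_lmul_matrix Av dot_square_norm)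
  moreover have "v \<bullet> v = 1" using v by (simp add: dot_square_norm)
  ultimately have "(?w - \<sigma> *\<^sub>R v) \<bullet> (?w - \<sigma> *\<^sub>R v) \<le> 0"
    by (simp add: algebra_simps inner_commute power2_eq_square)
  then have "?w = \<sigma> *\<^sub>R v"
    by (metis inner_ge_zero inner_eq_zero_iff eq_iff_diff_eq_0 order_antisym)
  then show ?thesis using that[of \<sigma> u v] \<open>\<sigma> > 0\<close> nu v Av bound by (simp add: dot_square_norm)
qed

lemma orthonormal_upto_case_nat:
  assumes "orthonormal_upto q u" "a \<bullet> a = 1" "\<And>l. l < q \<Longrightarrow> a \<bullet> u l = 0"
  shows "orthonormal_upto (Suc q) (case_nat a u)"
  using assms by (auto simp: orthonormal_upto_def inner_commute split: nat.splits)

text \<open>Deflation: subtracting the top singular component lowers the rank, so induction on the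
  rank supplies a decomposition of the rest, and the top component is put in front of it.\<close>

lemma is_svd_exists:
  fixes A :: "real^'n^'m"
  shows "\<exists>s u v. is_svd A s u v"
proof (induction "rank A" arbitrary: A rule: less_induct)
  case less
  show ?case
  proof (cases "A = 0")
    case True
    then have "is_svd A [] (\<lambda>_. 0) (\<lambda>_. 0)"
      by (simp add: is_svd_def orthonormal_upto_def svd_partial_sum_def)
    then show ?thesis by blast
  next
    case False
    then obtain \<sigma> u v where top: "0 < \<sigma>" "u \<bullet> u = 1" "v \<bullet> v = 1" "A *v v = \<sigma> *\<^sub>R u"
      "u v* A = \<sigma> *\<^sub>R v" "\<And>x. norm (A *v x) \<le> \<sigma> * norm x"
      using exists_top_singular_pair by blast
    define A' where "A' = A - \<sigma> *\<^sub>R outer_product u v"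
    have A'x: "A' *v x = A *v x - (\<sigma> * (v \<bullet> x)) *\<^sub>R u" for x
      by (simp add: A'_def matrix_vector_mult_diff_rdistrib outer_product_mult_vec
          flip: scaleR_matrix_vector_assoc)
    have A'v: "A' *v v = 0" using top by (simp add: A'x)
    have uA': "u \<bullet> (A' *v x) = 0" for x
      using top by (simp add: A'x inner_diff_right flip: dot_lmul_matrix)
    have u_in: "u = A *v ((1 / \<sigma>) *\<^sub>R v)" using top by (simp add: matrix_vector_mult_scaleR)
    have "A' *v x = A *v (x - (v \<bullet> x) *\<^sub>R v)" for x
      using top by (simp add: A'x matrix_vector_mult_diff_distrib matrix_vector_mult_scaleR)
    then have sub: "range ((*v) A') \<subseteq> range ((*v) A)" by auto
    \<comment> \<open>The rank drops strictly because \<open>u\<close> lies in the range of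
      \<open>A\<close>, whereas the range of \<open>A'\<close> is orthogonal to
      \<open>u\<close>.\<close>
    have "u \<notin> range ((*v) A')" using uA' top(2) by auto
    moreover have "u \<in> range ((*v) A)" using u_in by blast
    ultimately have "range ((*v) A') \<subset> range ((*v) A)" using sub by blast
    moreover have "span (range ((*v) M)) = range ((*v) M)" for M :: "real^'n^'m"
      by (intro span_eq_iff[THEN iffD2] linear_subspace_image) auto
    ultimately have "rank A' < rank A"
      unfolding rank_dim_range by (metis dim_psubset)
    from less[OF this] obtain s' u' v' where svd': "is_svd A' s' u' v'" by blast
    note svd = is_svdD[OF svd']
    \<comment> \<open>Having nonzero singular values, the vectors \<open>u' l\<close> and
      \<open>v' l\<close> lie in the column space and the row space of \<open>A'\<close>; these are
      orthogonal to \<open>u\<close> and \<open>v\<close> respectively.\<close>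
    have u'_eq: "u' l = (1 / s' ! l) *\<^sub>R (A' *v v' l)"
      and v'_eq: "v' l = (1 / s' ! l) *\<^sub>R (u' l v* A')" if "l < length s'" for l
      using svd(4,6,7)[OF that] by simp_all
    have vv': "v \<bullet> v' l = 0" if "l < length s'" for l
    proof -
      have "v \<bullet> v' l = (1 / s' ! l) * ((u' l v* A') \<bullet> v)"
        using v'_eq[OF that] by (metis inner_commute inner_scaleR_right)
      then show ?thesis by (simp add: dot_lmul_matrix A'v)
    qed
    have uu': "u \<bullet> u' l = 0" if "l < length s'" for l
      using u'_eq[OF that] uA' by (metis inner_scaleR_right mult_zero_right)
    have le: "s' ! l \<le> \<sigma>" if "l < length s'" for l
    proof -
      have "norm (u' l) = 1" "norm (v' l) = 1"
        using svd(1,2) that by (simp_all add: norm_eq_1 orthonormal_uptoD)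
      moreover have "A *v v' l = s' ! l *\<^sub>R u' l"
        using svd(6)[OF that] vv'[OF that] by (simp add: A'x)
      ultimately show ?thesis using top(6)[of "v' l"] svd(4)[OF that] by simp
    qed
    let ?s = "\<sigma> # s'" and ?u = "case_nat u u'" and ?v = "case_nat v v'"
    have "svd_partial_sum (length ?s) ?s ?u ?v = \<sigma> *\<^sub>R outer_product u v + A'"
      using svd(3) by (simp add: svd_partial_sum_def sum.lessThan_Suc_shift del: sum.lessThan_Suc)
    then have "is_svd A ?s ?u ?v"
      using svd' le uu' vv' top
      by (auto simp: is_svd_def A'_def in_set_conv_nth intro!: orthonormal_upto_case_nat)
    then show ?thesis by blast
  qed
qed

section \<open>Uniqueness in the Eckart--Young theorem\<close>

lemma inner_orthonormal_sum:
  assumes "orthonormal_upto q v" "j < q"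
  shows "(\<Sum>l<q. a l *\<^sub>R v l) \<bullet> v j = a j"
proof -
  have "(\<Sum>l<q. a l *\<^sub>R v l) \<bullet> v j = (\<Sum>l<q. if l = j then a j else 0)"
    unfolding inner_sum_left using assms by (intro sum.cong) (auto simp: orthonormal_uptoD)
  then show ?thesis using assms by simp
qed

lemma inner_orthonormal_sum_self:
  assumes "orthonormal_upto q v"
  shows "(\<Sum>l<q. a l *\<^sub>R v l) \<bullet> (\<Sum>l<q. a l *\<^sub>R v l) = (\<Sum>l<q. (a l)\<^sup>2)"
  by (subst inner_sum_right) (use assms in \<open>simp add: inner_orthonormal_sum power2_eq_square\<close>)

lemma orthonormal_residual:
  assumes "orthonormal_upto q v"
  shows "(x - (\<Sum>l<q. (v l \<bullet> x) *\<^sub>R v l)) \<bullet> (x - (\<Sum>l<q. (v l \<bullet> x) *\<^sub>R v l))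
    = x \<bullet> x - (\<Sum>l<q. (v l \<bullet> x)\<^sup>2)"
proof -
  let ?p = "\<Sum>l<q. (v l \<bullet> x) *\<^sub>R v l"
  have "?p \<bullet> ?p = (\<Sum>l<q. (v l \<bullet> x)\<^sup>2)"
    by (rule inner_orthonormal_sum_self[OF assms])
  moreover have "?p \<bullet> x = (\<Sum>l<q. (v l \<bullet> x)\<^sup>2)"
    by (simp add: inner_sum_left power2_eq_square)
  ultimately show ?thesis by (simp add: inner_diff_left inner_diff_right inner_commute)
qed

lemma bessel_inequality:
  assumes "orthonormal_upto q v"
  shows "(\<Sum>l<q. (v l \<bullet> x)\<^sup>2) \<le> x \<bullet> x"
  using orthonormal_residual[OF assms, of x]
    inner_ge_zero[of "x - (\<Sum>l<q. (v l \<bullet> x) *\<^sub>R v l)"] by linarith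

lemma bessel_equality:
  assumes "orthonormal_upto q v" "(\<Sum>l<q. (v l \<bullet> x)\<^sup>2) = x \<bullet> x"
  shows "(\<Sum>l<q. (v l \<bullet> x) *\<^sub>R v l) = x"
  using orthonormal_residual[OF assms(1), of x] assms(2) by simp

text \<open>With each weight capped at 1 and total weight at most \<open>r\<close>, a weighted sum
  of \<open>c\<close> is largest when all weight sits on the first \<open>r\<close> indices. The
  threshold \<open>\<gamma>\<close> strictly separates their values from the others and makes this
  maximizer unique.\<close>

lemma capped_weights_extremal:
  fixes c w :: "nat \<Rightarrow> real"
  assumes "r \<le> p" and w: "\<And>l. l < p \<Longrightarrow> 0 \<le> w l \<and> w l \<le> 1" and wsum: "(\<Sum>l<p. w l) \<le> real r"
    and "0 \<le> \<gamma>" and hi: "\<And>l. l < r \<Longrightarrow> \<gamma> < c l" and lo: "\<And>l. r \<le> l \<Longrightarrow> l < p \<Longrightarrow> c l < \<gamma>"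
    and ge: "(\<Sum>l<r. c l) \<le> (\<Sum>l<p. c l * w l)"
    and "l < p"
  shows "w l = (if l < r then 1 else 0)"
proof -
  \<comment> \<open>Each \<open>d l\<close> is a nonnegative loss against the extremal weights. The
    losses add up to at most 0, so all vanish, and the strict separation by \<open>\<gamma>\<close>
    then determines every weight.\<close>
  define d where "d l = (if l < r then (c l - \<gamma>) * (1 - w l) else (\<gamma> - c l) * w l)" for l
  have d0: "0 \<le> d l" if "l < p" for l
    using w[OF that] hi[of l] lo[of l] that by (auto simp: d_def intro!: mult_nonneg_nonneg)
  have "(\<Sum>l<p. d l) = (\<Sum>l<p. (if l < r then c l - \<gamma> else 0) - c l * w l + \<gamma> * w l)"
    by (intro sum.cong) (auto simp: d_def algebra_simps)
  also have "\<dots> = (\<Sum>l<p. if l < r then c l - \<gamma> else 0) - (\<Sum>l<p. c l * w l) + \<gamma> * (\<Sum>l<p. w l)"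
    by (simp add: sum.distrib sum_subtractf sum_distrib_left)
  also have "(\<Sum>l<p. if l < r then c l - \<gamma> else 0) = (\<Sum>l<r. c l - \<gamma>)"
    using \<open>r \<le> p\<close> by (intro sum.mono_neutral_cong_right) auto
  also have "\<dots> = (\<Sum>l<r. c l) - \<gamma> * r"
    by (simp add: sum_subtractf)
  finally have "(\<Sum>l<p. d l) \<le> 0"
    using ge mult_left_mono[OF wsum \<open>0 \<le> \<gamma>\<close>] by linarith
  then have "(\<Sum>l<p. d l) = 0"
    using d0 by (intro antisym sum_nonneg) auto
  then have "d l = 0"
    using d0 \<open>l < p\<close> by (subst (asm) sum_nonneg_eq_0_iff) auto
  then show ?thesis using hi[of l] lo[of l] \<open>l < p\<close> by (auto simp: d_def split: if_splits)
qed

lemma separating_value: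
  fixes f :: "nat \<Rightarrow> real"
  assumes "\<And>i j. i < r \<Longrightarrow> r \<le> j \<Longrightarrow> j < p \<Longrightarrow> f j < f i" "\<And>i. i < r \<Longrightarrow> 0 < f i"
  obtains \<gamma> where "0 \<le> \<gamma>" "\<And>i. i < r \<Longrightarrow> \<gamma> < f i" "\<And>j. r \<le> j \<Longrightarrow> j < p \<Longrightarrow> f j < \<gamma>"
proof -
  define a where "a = Max (insert 0 (f ` {r..<p}))"
  \<comment> \<open>Inserting \<open>a + 1\<close> keeps the set nonempty when \<open>r = 0\<close>
    and does not spoil \<open>a < b\<close>; the 0 inserted in \<open>a\<close> makes the threshold
    nonnegative.\<close>
  define b where "b = Min (insert (a + 1) (f ` {..<r}))"
  have "a < f i" if "i < r" for i
    using assms that by (auto simp: a_def)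
  then have "a < b" by (auto simp: b_def)
  then obtain \<gamma> where \<gamma>: "a < \<gamma>" "\<gamma> < b" using dense by blast
  show ?thesis
  proof
    show "0 \<le> \<gamma>" "\<And>i. i < r \<Longrightarrow> \<gamma> < f i" "\<And>j. r \<le> j \<Longrightarrow> j < p \<Longrightarrow> f j < \<gamma>"
      using \<gamma> by (auto simp: a_def b_def)
  qed
qed

text \<open>For fixed left singular vectors of \<open>B\<close>, the error splits into a term
  determined by the space they span and a sum of squares. The extremal weight lemma determines the
  space, and the squares must vanish. A gap after the first \<open>r\<close> values is assumed in
  place of sortedness, since the lemma is also applied to a concatenated list of singular
  values.\<close>

lemma eckart_young_unique:
  fixes A B :: "real^'n^'k"
  assumes U: "orthonormal_upto p U" and V: "orthonormal_upto p V" and A: "A = svd_partial_sum p S U V"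
    and "r \<le> p" and pos: "\<And>l. l < p \<Longrightarrow> 0 < S ! l"
    and gap: "\<And>i j. i < r \<Longrightarrow> r \<le> j \<Longrightarrow> j < p \<Longrightarrow> S ! j < S ! i"
    and B: "rank B = r" and le: "norm (B - A) \<le> norm (svd_partial_sum r S U V - A)"
  shows "B = svd_partial_sum r S U V"
proof -
  let ?B0 = "svd_partial_sum r S U V"
  have Ur: "orthonormal_upto r U" and Vr: "orthonormal_upto r V"
    using U V \<open>r \<le> p\<close> by (auto simp: orthonormal_upto_def)
  obtain \<gamma> where "0 \<le> \<gamma>" and hi: "\<And>l. l < r \<Longrightarrow> \<gamma> < S ! l"
    and lo: "\<And>l. r \<le> l \<Longrightarrow> l < p \<Longrightarrow> S ! l < \<gamma>"
    by (rule separating_value[of r p "\<lambda>l. S ! l"]) (use gap pos \<open>r \<le> p\<close> in auto)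
  obtain t q b where svdB: "is_svd B t q b" using is_svd_exists by blast
  have len: "length t = r" using is_svd_rank[OF svdB] B by simp
  note svdB = is_svdD[OF svdB, unfolded len]
  \<comment> \<open>\<open>g i\<close> is the best possible value of
    \<open>t ! i *\<^sub>R b i\<close> once \<open>q i\<close> is fixed, and \<open>w l\<close> is
    the squared length of the projection of \<open>U l\<close> onto the span of the
    \<open>q i\<close>.\<close>
  define g where "g i = q i v* A" for i
  define w where "w l = (\<Sum>i<r. (q i \<bullet> U l)\<^sup>2)" for l
  have g_eq: "g i = (\<Sum>l<p. (S ! l * (U l \<bullet> q i)) *\<^sub>R V l)" for i
    by (simp add: g_def A vec_mult_svd_partial_sum)
  have gg: "g i \<bullet> g i = (\<Sum>l<p. (S ! l)\<^sup>2 * (q i \<bullet> U l)\<^sup>2)" for i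
    unfolding g_eq inner_orthonormal_sum_self[OF V] by (simp add: power_mult_distrib inner_commute)
  have AB0: "A \<bullet> ?B0 = (\<Sum>l<r. (S ! l)\<^sup>2)"
    unfolding inner_svd_partial_sum A using \<open>r \<le> p\<close>
    by (intro sum.cong) (auto simp: svd_partial_sum_right_vector[OF V] orthonormal_uptoD[OF U] power2_eq_square)
  have B0B0: "?B0 \<bullet> ?B0 = (\<Sum>l<r. (S ! l)\<^sup>2)"
    using svd_partial_sum_norm[OF Ur Vr] by (simp add: power2_norm_eq_inner)
  have BB: "B \<bullet> B = (\<Sum>i<r. (t ! i)\<^sup>2)"
    by (subst (1 2) svdB(3)) (simp add: svd_partial_sum_norm svdB(1,2) flip: power2_norm_eq_inner)
  have AB: "A \<bullet> B = (\<Sum>i<r. t ! i * (g i \<bullet> b i))"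
    by (subst svdB(3)) (simp add: inner_svd_partial_sum g_def dot_lmul_matrix)
  have "(norm (B - A))\<^sup>2 \<le> (norm (?B0 - A))\<^sup>2"
    using le by (simp add: power_mono)
  then have "(\<Sum>l<r. (S ! l)\<^sup>2) \<le> 2 * (A \<bullet> B) - B \<bullet> B"
    using AB0 B0B0 by (simp add: power2_norm_eq_inner inner_diff_left inner_diff_right inner_commute)
  \<comment> \<open>Completing the square in each component, using that \<open>b i\<close> is a unit
    vector.\<close>
  also have "\<dots> = (\<Sum>i<r. g i \<bullet> g i) - (\<Sum>i<r. (t ! i *\<^sub>R b i - g i) \<bullet> (t ! i *\<^sub>R b i - g i))"
    unfolding AB BB sum_distrib_left sum_subtractf[symmetric]
    using orthonormal_uptoD[OF svdB(2)]
    by (intro sum.cong) (auto simp: inner_diff_left inner_diff_right inner_commute power2_eq_square)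
  also have "(\<Sum>i<r. g i \<bullet> g i) = (\<Sum>l<p. (S ! l)\<^sup>2 * w l)"
    unfolding gg w_def sum_distrib_left by (rule sum.swap)
  finally have ge: "(\<Sum>l<r. (S ! l)\<^sup>2) + (\<Sum>i<r. (t ! i *\<^sub>R b i - g i) \<bullet> (t ! i *\<^sub>R b i - g i))
      \<le> (\<Sum>l<p. (S ! l)\<^sup>2 * w l)" by linarith
  have nonneg: "0 \<le> (\<Sum>i<r. (t ! i *\<^sub>R b i - g i) \<bullet> (t ! i *\<^sub>R b i - g i))"
    by (intro sum_nonneg) simp
  \<comment> \<open>Bessel's inequality is used twice: for the family \<open>U\<close> it bounds the
    total weight by \<open>r\<close>, and for the family \<open>q\<close> it bounds each single
    weight by 1.\<close>
  have "(\<Sum>l<p. w l) = (\<Sum>i<r. \<Sum>l<p. (U l \<bullet> q i)\<^sup>2)"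
    unfolding w_def by (subst sum.swap) (simp add: inner_commute)
  also have "\<dots> \<le> (\<Sum>i<r. q i \<bullet> q i)"
    by (intro sum_mono bessel_inequality[OF U])
  also have "\<dots> = r" using orthonormal_uptoD[OF svdB(1)] by simp
  finally have wsum: "(\<Sum>l<p. w l) \<le> r" .
  have w01: "0 \<le> w l \<and> w l \<le> 1" if "l < p" for l
    using bessel_inequality[OF svdB(1), of "U l"] orthonormal_uptoD[OF U that that]
    by (auto simp: w_def intro: sum_nonneg)
  have w: "w l = (if l < r then 1 else 0)" if "l < p" for l
  proof (rule capped_weights_extremal[OF \<open>r \<le> p\<close> w01 wsum, of "\<gamma>\<^sup>2" "\<lambda>l. (S ! l)\<^sup>2"])
    show "\<gamma>\<^sup>2 < (S ! l)\<^sup>2" if "l < r" for l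
      using hi[OF that] \<open>0 \<le> \<gamma>\<close> by (simp add: power_strict_mono)
    show "(S ! l)\<^sup>2 < \<gamma>\<^sup>2" if "r \<le> l" "l < p" for l
      using lo[OF that] pos[of l] that by (simp add: power_strict_mono)
  qed (use ge nonneg that in auto)
  have "(\<Sum>l<p. (S ! l)\<^sup>2 * w l) = (\<Sum>l<r. (S ! l)\<^sup>2)"
    using \<open>r \<le> p\<close> w by (intro sum.mono_neutral_cong_right) auto
  then have "(\<Sum>i<r. (t ! i *\<^sub>R b i - g i) \<bullet> (t ! i *\<^sub>R b i - g i)) = 0"
    using ge nonneg by linarith
  then have tb: "t ! i *\<^sub>R b i = g i" if "i < r" for i
    using that by (subst (asm) sum_nonneg_eq_0_iff) auto
  \<comment> \<open>Weight 1 is the equality case of Bessel's inequality and puts \<open>U l\<close>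
    in the span of the \<open>q i\<close>; weight 0 makes it orthogonal to that span.\<close>
  have proj: "(\<Sum>i<r. (q i \<bullet> U l) *\<^sub>R q i) = (if l < r then U l else 0)" if "l < p" for l
  proof (cases "l < r")
    case True
    then show ?thesis
      using bessel_equality[OF svdB(1), of "U l"] w[OF that] orthonormal_uptoD[OF U that that]
      by (simp add: w_def)
  next
    case False
    then have "(\<Sum>i<r. (q i \<bullet> U l)\<^sup>2) = 0" using w[OF that] by (simp add: w_def)
    then have "\<forall>i<r. q i \<bullet> U l = 0" by (subst (asm) sum_nonneg_eq_0_iff) auto
    then show ?thesis using False by simp
  qed
  show ?thesis
  \<comment> \<open>By \<open>tb\<close>, \<open>B\<close> is the projection of \<open>A\<close>
    onto the span of the \<open>q i\<close>; by \<open>proj\<close>, this projection keeps the first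
    \<open>r\<close> components of \<open>A\<close> and kills the others.\<close>
  proof (rule matrix_eqI)
    fix x
    have "B *v x = (\<Sum>i<r. (t ! i * (b i \<bullet> x)) *\<^sub>R q i)"
      by (subst svdB(3)) (rule svd_partial_sum_mult_vec)
    also have "\<dots> = (\<Sum>i<r. (g i \<bullet> x) *\<^sub>R q i)"
      by (intro sum.cong) (simp_all flip: tb)
    also have "\<dots> = (\<Sum>i<r. \<Sum>l<p. (S ! l * (V l \<bullet> x)) *\<^sub>R ((q i \<bullet> U l) *\<^sub>R q i))"
      by (simp add: g_eq inner_sum_left inner_sum_right scaleR_sum_left inner_commute mult_ac)
    also have "\<dots> = (\<Sum>l<p. (S ! l * (V l \<bullet> x)) *\<^sub>R (\<Sum>i<r. (q i \<bullet> U l) *\<^sub>R q i))"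
      by (subst sum.swap) (simp add: scaleR_sum_right)
    also have "\<dots> = (\<Sum>l<p. (S ! l * (V l \<bullet> x)) *\<^sub>R (if l < r then U l else 0))"
      by (intro sum.cong) (auto simp: proj)
    also have "\<dots> = (\<Sum>l<r. (S ! l * (V l \<bullet> x)) *\<^sub>R U l)"
      using \<open>r \<le> p\<close> by (intro sum.mono_neutral_cong_right) auto
    finally show "B *v x = ?B0 *v x" by (simp add: svd_partial_sum_mult_vec)
  qed
qed

section \<open>Local minima on the rank manifold\<close>

text \<open>Strictness says nothing at \<open>w\<close> itself, so a path that may return to
  \<open>w\<close> needs the first alternative.\<close>

lemma strict_local_min_on_path:
  fixes w :: "'a::topological_space"
  assumes "strict_local_min_on S f w" "(\<gamma> \<longlongrightarrow> w) F" "\<forall>\<^sub>F t in F. \<gamma> t \<in> S"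
  shows "\<forall>\<^sub>F t in F. \<gamma> t = w \<or> f w < f (\<gamma> t)"
proof -
  obtain T where T: "open T" "w \<in> T" "\<And>z. z \<in> S \<Longrightarrow> z \<in> T \<Longrightarrow> z \<noteq> w \<Longrightarrow> f w < f z"
    using assms(1) unfolding strict_local_min_on_def openin_open by auto
  have "\<forall>\<^sub>F t in F. \<gamma> t \<in> T"
    using assms(2) T(1,2) by (rule topological_tendstoD)
  with assms(3) show ?thesis
    by eventually_elim (use T(3) in blast)
qed

lemma add_matrix_mult: "(A + B) ** (C :: real^'p^'n) = A ** C + B ** C"
  by (rule matrix_eqI) (simp add: matrix_vector_mul_assoc[symmetric] matrix_vector_mult_add_rdistrib)

lemma inner_matrix_vector_mult: "((A :: real^'n^'m) *v x) \<bullet> y = x \<bullet> (y v* A)"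
  by (metis dot_lmul_matrix inner_commute)

lemma linear_matrix_mult_right: "linear (\<lambda>M. M ** (P :: real^'p^'n))"
  by (rule linearI) (simp_all add: add_matrix_mult scaleR_matrix_matrix_mult)

lemma tendsto_outer_product:
  assumes "(f \<longlongrightarrow> a) F" "(g \<longlongrightarrow> b) F"
  shows "((\<lambda>t. outer_product (f t) (g t)) \<longlongrightarrow> outer_product a b) F"
  unfolding outer_product_def by (intro tendsto_vec_lambda tendsto_mult tendsto_vec_nth assms)

lemma tendsto_svd_partial_sum:
  assumes "\<And>l. l < q \<Longrightarrow> ((\<lambda>t. u t l) \<longlongrightarrow> u' l) F" "\<And>l. l < q \<Longrightarrow> ((\<lambda>t. v t l) \<longlongrightarrow> v' l) F"
  shows "((\<lambda>t. svd_partial_sum q s (u t) (v t)) \<longlongrightarrow> svd_partial_sum q s u' v') F"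
  unfolding svd_partial_sum_def using assms
  by (intro tendsto_sum tendsto_scaleR tendsto_const tendsto_outer_product) auto

text \<open>Expanding the squared norms and dividing by \<open>t\<close> leaves
  \<open>2 * (E \<bullet> G)\<close> bounded by a term that tends to 0 with
  \<open>t\<close>.\<close>

lemma inner_nonpos_of_local_min:
  fixes E G :: "'a::real_inner"
  assumes "\<forall>\<^sub>F t in at_right 0. norm E \<le> norm (E - t *\<^sub>R G)"
  shows "E \<bullet> G \<le> 0"
proof -
  have "\<forall>\<^sub>F t::real in at_right 0. 2 * (E \<bullet> G) \<le> t * (G \<bullet> G)"
    using assms eventually_at_right_less[of 0]
  proof eventually_elim
    case (elim t)
    then have "(norm E)\<^sup>2 \<le> (norm (E - t *\<^sub>R G))\<^sup>2" by (simp add: power_mono)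
    then have "t * (2 * (E \<bullet> G)) \<le> t * (t * (G \<bullet> G))"
      by (simp add: power2_norm_eq_inner inner_diff_left inner_diff_right inner_commute)
    with elim show ?case by simp
  qed
  moreover have "((\<lambda>t::real. t * (G \<bullet> G)) \<longlongrightarrow> 0 * (G \<bullet> G)) (at_right 0)"
    by (intro tendsto_intros)
  ultimately have "2 * (E \<bullet> G) \<le> 0 * (G \<bullet> G)"
    by (intro tendsto_lowerbound[where F = "at_right (0::real)"]) auto
  then show ?thesis by simp
qed

text \<open>A nonzero kernel vector of \<open>mat 1 - t M\<close> would be reproduced by
  \<open>t M\<close>, which is impossible once \<open>t\<close> times the operator norm of
  \<open>M\<close> is below 1. Adding 1 to that norm in \<open>?c\<close> keeps the divisor
  positive.\<close>

lemma eventually_left_invertible: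
  fixes M :: "real^'n^'n"
  shows "\<forall>\<^sub>F t in at_right 0. \<exists>N. N ** (mat 1 - t *\<^sub>R M) = mat 1"
proof -
  let ?c = "onorm ((*v) M) + 1"
  have c: "norm (M *v x) \<le> onorm ((*v) M) * norm x" for x
    by (rule onorm) simp
  have "0 < ?c" using onorm_pos_le[of "(*v) M"] by simp
  show ?thesis
  proof (rule eventually_at_rightI)
    show "0 < 1 / ?c" using \<open>0 < ?c\<close> by simp
    fix t assume t: "t \<in> {0<..<1 / ?c}"
    have "x = 0" if "(mat 1 - t *\<^sub>R M) *v x = 0" for x
    proof (rule ccontr)
      assume "x \<noteq> 0"
      have "x = t *\<^sub>R (M *v x)"
        using that by (simp add: matrix_vector_mult_diff_rdistrib flip: scaleR_matrix_vector_assoc)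
      then have "norm x = t * norm (M *v x)"
        using t by (metis abs_of_pos greaterThanLessThan_iff norm_scaleR)
      also have "\<dots> \<le> t * (onorm ((*v) M) * norm x)"
        using c[of x] t by (intro mult_left_mono) auto
      also have "\<dots> < t * ?c * norm x"
        using t \<open>x \<noteq> 0\<close> by (simp add: algebra_simps)
      also have "\<dots> < 1 * norm x"
        using t \<open>x \<noteq> 0\<close> \<open>0 < ?c\<close> by (intro mult_strict_right_mono) (auto simp: field_simps)
      finally show False by simp
    qed
    then show "\<exists>N. N ** (mat 1 - t *\<^sub>R M) = mat 1"
      by (simp add: matrix_left_invertible_ker)
  qed
qed

lemma rank_mult_left_invertible:
  assumes "N ** M = mat 1"
  shows "rank (M ** B) = rank (B :: real^'n^'m)"
proof (rule antisym)
  have "rank B = rank (N ** (M ** B))" using assms by (simp add: matrix_mul_assoc)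
  then show "rank B \<le> rank (M ** B)" by (metis rank_mul_le_right)
qed (rule rank_mul_le_right)

lemma rank_mult_right_invertible:
  assumes "M ** N = mat 1"
  shows "rank (B ** M) = rank (B :: real^'n^'m)"
proof (rule antisym)
  have "rank B = rank (B ** M ** N)" using assms by (simp flip: matrix_mul_assoc)
  then show "rank B \<le> rank (B ** M)" by (metis rank_mul_le_left)
qed (rule rank_mul_le_left)

lemma orthonormal_upto_append:
  assumes "orthonormal_upto q u" "orthonormal_upto n u'"
    and cross: "\<And>i j. i < q \<Longrightarrow> j < n \<Longrightarrow> u i \<bullet> u' j = 0"
  shows "orthonormal_upto (q + n) (\<lambda>l. if l < q then u l else u' (l - q))"
proof -
  have "u' j \<bullet> u i = 0" if "i < q" "j < n" for i j
    using cross[OF that] by (metis inner_commute)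
  then show ?thesis
    using assms by (auto simp: orthonormal_upto_def)
qed

text \<open>Only the entry \<open>i\<close> is changed. In its uses \<open>j\<close> lies beyond the
  retained \<open>r\<close> vectors, so the first \<open>r\<close> entries stay orthonormal without
  rotating the entry \<open>j\<close> as well.\<close>

definition rotate_pair :: "nat \<Rightarrow> nat \<Rightarrow> real \<Rightarrow> (nat \<Rightarrow> 'a::real_vector) \<Rightarrow> nat \<Rightarrow> 'a" where
  "rotate_pair i j t u = u(i := cos t *\<^sub>R u i + sin t *\<^sub>R u j)"

lemma tendsto_rotate_pair:
  fixes u :: "nat \<Rightarrow> 'a::real_normed_vector"
  shows "((\<lambda>t. rotate_pair i j t u l) \<longlongrightarrow> u l) (at_right 0)"
proof -
  have "((\<lambda>t. cos t *\<^sub>R u i + sin t *\<^sub>R u j) \<longlongrightarrow> cos 0 *\<^sub>R u i + sin 0 *\<^sub>R u j) (at_right 0)"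
    by (intro tendsto_intros)
  then show ?thesis by (cases "l = i") (simp_all add: rotate_pair_def)
qed

lemma orthonormal_rotate_pair:
  assumes "orthonormal_upto p u" "r \<le> p" "i < r" "r \<le> j" "j < p"
  shows "orthonormal_upto r (rotate_pair i j t u)"
  using assms unfolding orthonormal_upto_def rotate_pair_def
  by (auto simp: inner_add_left inner_add_right simp flip: power2_eq_square)

section \<open>First-order conditions and the gap at a strict local minimizer\<close>

context
  fixes A B :: "real^'n^'k" and K :: "real^'n^'n" and r :: nat
  assumes AK: "A ** K = A"
    and min: "strict_local_min_on {M. rank M = r \<and> M ** K = M} (\<lambda>M. norm (M - A)) B"
begin

lemma min_rank: "rank B = r" and min_K: "B ** K = B"
  using min by (auto simp: strict_local_min_on_def)

text \<open>The constraint \<open>M ** K = M\<close> is linear, so the straight path in direction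
  \<open>- G\<close> preserves it; only the rank along the path has to be controlled.\<close>

lemma gradient_nonpos:
  assumes "\<forall>\<^sub>F t in at_right 0. rank (B - t *\<^sub>R G) = r" "G ** K = G"
  shows "(B - A) \<bullet> G \<le> 0"
proof (rule inner_nonpos_of_local_min)
  have "((\<lambda>t. B - t *\<^sub>R G) \<longlongrightarrow> B) (at_right 0)"
    by (auto intro!: tendsto_eq_intros)
  moreover have "\<forall>\<^sub>F t in at_right 0. B - t *\<^sub>R G \<in> {M. rank M = r \<and> M ** K = M}"
    using assms(1) by eventually_elim (simp add: diff_matrix_mult scaleR_matrix_matrix_mult assms min_K)
  ultimately have "\<forall>\<^sub>F t in at_right 0. B - t *\<^sub>R G = B \<or> norm (B - A) < norm (B - t *\<^sub>R G - A)"
    by (rule strict_local_min_on_path[OF min])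
  then show "\<forall>\<^sub>F t in at_right 0. norm (B - A) \<le> norm (B - A - t *\<^sub>R G)"
    by eventually_elim (auto simp: algebra_simps)
qed

text \<open>Multiplying \<open>B\<close> by \<open>mat 1 - t M\<close> on the left or
  \<open>mat 1 - t N\<close> on the right keeps its rank for small \<open>t\<close>. With
  \<open>M\<close> and \<open>N\<close> chosen as the products to be killed, the directional
  derivative is the squared norm of that product, which therefore vanishes.\<close>

lemma residual_orthogonal: "(B - A) ** transpose B = 0" "transpose B ** (B - A) = 0"
proof -
  let ?E = "B - A"
  have EK: "?E ** K = ?E" by (simp add: diff_matrix_mult AK min_K)
  let ?M = "?E ** transpose B"
  have "\<forall>\<^sub>F t in at_right 0. rank (B - t *\<^sub>R (?M ** B)) = r"
    using eventually_left_invertible[of ?M]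
  proof eventually_elim
    case (elim t)
    then show ?case
      using rank_mult_left_invertible[of _ "mat 1 - t *\<^sub>R ?M" B] min_rank
      by (auto simp: diff_matrix_mult scaleR_matrix_matrix_mult)
  qed
  then have "?E \<bullet> (?M ** B) \<le> 0"
    by (rule gradient_nonpos) (simp add: min_K flip: matrix_mul_assoc)
  then have "?M \<bullet> ?M \<le> 0" by (simp add: inner_mult_right_transpose transpose_transpose)
  then show "?M = 0" by (metis inner_ge_zero inner_eq_zero_iff order_antisym)
  \<comment> \<open>On this side the direction \<open>B ** ?N\<close> satisfies the constraint
    because it ends in the factor \<open>?E\<close>, and \<open>?E ** K = ?E\<close>.\<close>
  let ?N = "transpose B ** ?E"
  have "\<forall>\<^sub>F t in at_right 0. rank (B - t *\<^sub>R (B ** ?N)) = r"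
    using eventually_left_invertible[of ?N]
  proof eventually_elim
    case (elim t)
    have "B ** (mat 1 - t *\<^sub>R ?N) = B - t *\<^sub>R (B ** ?N)"
      by (rule matrix_eqI) (simp add: matrix_vector_mul_assoc[symmetric]
          matrix_vector_mult_diff_rdistrib matrix_vector_mult_diff_distrib matrix_vector_mult_scaleR
          scaleR_matrix_vector_assoc[symmetric] del: transpose_matrix_vector)
    then show ?case
      using elim rank_mult_right_invertible[of "mat 1 - t *\<^sub>R ?N" _ B] min_rank
        matrix_left_right_inverse by metis
  qed
  then have "?E \<bullet> (B ** ?N) \<le> 0"
    by (rule gradient_nonpos) (simp add: EK flip: matrix_mul_assoc)
  then have "?N \<bullet> ?N \<le> 0"
    by (simp add: inner_mult_left_transpose transpose_transpose)
  then show "?N = 0" by (metis inner_ge_zero inner_eq_zero_iff order_antisym)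
qed

text \<open>Orthogonality of the residual to \<open>B\<close> on both sides lets the singular
  vectors of \<open>B\<close> and of \<open>A - B\<close> be concatenated. The concatenated list
  \<open>S\<close> may be unsorted at the junction, so no order is claimed here.\<close>

lemma min_is_partial_svd:
  obtains p S U V where "orthonormal_upto p U" "orthonormal_upto p V" "A = svd_partial_sum p S U V"
    "B = svd_partial_sum r S U V" "r \<le> p" "\<And>l. l < p \<Longrightarrow> 0 < S ! l"
proof -
  let ?E = "A - B"
  obtain s q b where B: "is_svd B s q b" using is_svd_exists by blast
  have len: "length s = r" using is_svd_rank[OF B] min_rank by simp
  note B = is_svdD[OF B, unfolded len]
  obtain s' q' b' where "is_svd ?E s' q' b'" using is_svd_exists by blast
  note E = is_svdD[OF this]
  have 1: "?E ** transpose B = 0" "transpose B ** ?E = 0"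
    using residual_orthogonal by (simp_all add: matrix_eq algebra_simps flip: matrix_vector_mul_assoc)
  \<comment> \<open>Up to positive factors, \<open>q i\<close> and \<open>q' j\<close> are images
    under \<open>B\<close> and \<open>?E\<close>, so their inner product is an entry of the
    vanishing product \<open>transpose B ** ?E\<close> in the right singular vectors. The next fact
    is dual.\<close>
  have qq: "q i \<bullet> q' j = 0" if "i < r" "j < length s'" for i j
  proof -
    have "(s ! i *\<^sub>R q i) \<bullet> (s' ! j *\<^sub>R q' j) = (B *v b i) \<bullet> (?E *v b' j)"
      using B(6) E(6) that by simp
    also have "\<dots> = b i \<bullet> ((transpose B ** ?E) *v b' j)"
      by (simp add: inner_matrix_vector_mult flip: matrix_vector_mul_assoc)
    finally show ?thesis using 1 B(4)[of i] E(4)[of j] that by simp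
  qed
  have bb: "b i \<bullet> b' j = 0" if "i < r" "j < length s'" for i j
  proof -
    have "(s ! i *\<^sub>R b i) \<bullet> (s' ! j *\<^sub>R b' j) = (q i v* B) \<bullet> (q' j v* ?E)"
      using B(7) E(7) that by simp
    also have "\<dots> = ((?E ** transpose B) *v q i) \<bullet> q' j"
      by (simp add: inner_matrix_vector_mult flip: matrix_vector_mul_assoc)
    finally show ?thesis using 1 B(4)[of i] E(4)[of j] that by simp
  qed
  define U where "U l = (if l < r then q l else q' (l - r))" for l
  define V where "V l = (if l < r then b l else b' (l - r))" for l
  let ?S = "s @ s'" and ?p = "r + length s'"
  \<comment> \<open>Stated for every \<open>n\<close> so that \<open>n = 0\<close> gives
    \<open>B\<close> and \<open>n = length s'\<close> gives \<open>A\<close>.\<close>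
  have split: "svd_partial_sum (r + n) ?S U V = svd_partial_sum r s q b + svd_partial_sum n s' q' b'" for n
    by (induction n) (auto simp: svd_partial_sum_def U_def V_def len nth_append intro!: sum.cong)
  show ?thesis
  proof
    show "orthonormal_upto ?p U" "orthonormal_upto ?p V"
      unfolding U_def V_def using qq bb B(1,2) E(1,2) by (simp_all add: orthonormal_upto_append)
    show "A = svd_partial_sum ?p ?S U V"
      using split[of "length s'"] B(3) E(3) by (metis add.commute diff_add_cancel)
    show "B = svd_partial_sum r ?S U V"
      using split[of 0] B(3) by (simp add: svd_partial_sum_def)
    show "0 < ?S ! l" if "l < ?p" for l
      using that B(4) E(4) len by (auto simp: nth_append)
  qed simp
qed

text \<open>If the gap fails, rotating the \<open>i\<close>-th singular pair towards the \<open>j\<close>-th one never moves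
  away from \<open>A\<close>.\<close>

lemma min_gap:
  assumes U: "orthonormal_upto p U" and V: "orthonormal_upto p V" and A: "A = svd_partial_sum p S U V"
    and B: "B = svd_partial_sum r S U V" and "r \<le> p" and pos: "\<And>l. l < p \<Longrightarrow> 0 < S ! l"
    and i: "i < r" and j: "r \<le> j" "j < p"
  shows "S ! j < S ! i"
proof (rule ccontr)
  assume "\<not> S ! j < S ! i"
  then have ge: "S ! i \<le> S ! j" by simp
  note UU = orthonormal_uptoD[OF U] and VV = orthonormal_uptoD[OF V]
  have Ur: "orthonormal_upto r U" and Vr: "orthonormal_upto r V"
    using U V \<open>r \<le> p\<close> by (auto simp: orthonormal_upto_def)
  define C where "C t = svd_partial_sum r S (rotate_pair i j t U) (rotate_pair i j t V)" for t
  have orth: "orthonormal_upto r (rotate_pair i j t U)" "orthonormal_upto r (rotate_pair i j t V)" for t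
    using orthonormal_rotate_pair U V \<open>r \<le> p\<close> i j by blast+
  have AV: "A *v V l = S ! l *\<^sub>R U l" if "l < p" for l
    unfolding A using V that by (rule svd_partial_sum_right_vector)
  \<comment> \<open>Each \<open>V l\<close> with \<open>l < p\<close> is a combination of rows of
    \<open>A\<close>, and \<open>A ** K = A\<close>; hence the rotated vectors also respect the
    constraint.\<close>
  have VK: "V l v* K = V l" if "l < p" for l
  proof -
    have UA: "U l v* A = S ! l *\<^sub>R V l"
      unfolding A using U that by (rule svd_partial_sum_left_vector)
    then have "(S ! l *\<^sub>R V l) v* K = S ! l *\<^sub>R V l"
      by (metis AK vector_matrix_mul_assoc)
    then show ?thesis using pos[OF that] by (simp add: scaleR_vector_matrix_assoc)
  qed
  have "C t ** K = C t" for t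
    unfolding C_def svd_partial_sum_mult_matrix
    using VK i j \<open>r \<le> p\<close>
    by (intro svd_partial_sum_cong)
      (auto simp: rotate_pair_def vector_matrix_left_distrib scaleR_vector_matrix_assoc)
  moreover have "rank (C t) = r" for t
    unfolding C_def using pos \<open>r \<le> p\<close> by (intro rank_svd_partial_sum orth) auto
  ultimately have C_in: "C t \<in> {M. rank M = r \<and> M ** K = M}" for t by simp
  have "(C \<longlongrightarrow> B) (at_right 0)"
    unfolding C_def B by (intro tendsto_svd_partial_sum tendsto_rotate_pair)
  then have "\<forall>\<^sub>F t in at_right 0. C t = B \<or> norm (B - A) < norm (C t - A)"
    using C_in by (intro strict_local_min_on_path[OF min]) auto
  moreover have "\<forall>\<^sub>F t in at_right 0. 0 < sin (t :: real)"
    by (rule eventually_at_rightI[of 0 pi]) (auto intro: sin_gt_zero)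
  ultimately have "\<forall>\<^sub>F t in at_right 0. 0 < sin (t :: real) \<and> (C t = B \<or> norm (B - A) < norm (C t - A))"
    by eventually_elim simp
  then obtain t :: real where sin: "0 < sin t" and t: "C t = B \<or> norm (B - A) < norm (C t - A)"
    using eventually_happens'[OF trivial_limit_at_right_real] by blast
  \<comment> \<open>Rotation changes the singular vectors but not the singular values, so the norm
    is constant along \<open>C\<close> and the distances to \<open>A\<close> are compared through
    the inner products with \<open>A\<close> alone.\<close>
  have "(norm (C t))\<^sup>2 = (norm B)\<^sup>2"
    unfolding C_def B by (simp add: svd_partial_sum_norm orth Ur Vr)
  then have CC: "C t \<bullet> C t = B \<bullet> B" by (simp add: power2_norm_eq_inner)
  have "A \<bullet> B \<le> A \<bullet> C t"
    unfolding B C_def inner_svd_partial_sum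
  proof (intro sum_mono mult_left_mono)
    fix l assume "l \<in> {..<r}"
    then have l: "l < r" "l < p" using \<open>r \<le> p\<close> by auto
    show "0 \<le> S ! l" using pos[OF l(2)] by simp
    show "U l \<bullet> (A *v V l) \<le> rotate_pair i j t U l \<bullet> (A *v rotate_pair i j t V l)"
    proof (cases "l = i")
      case False
      then show ?thesis by (cases "l = i") (simp_all add: rotate_pair_def)
    next
      case True
      \<comment> \<open>The rotated pair contributes a weighted mean of \<open>S ! i\<close> and
        \<open>S ! j\<close>, which is at least \<open>S ! i\<close> when the gap fails.\<close>
      have "rotate_pair i j t U l \<bullet> (A *v rotate_pair i j t V l) = (cos t)\<^sup>2 * S ! i + (sin t)\<^sup>2 * S ! j"
        using True i j \<open>r \<le> p\<close>
        by (simp add: rotate_pair_def matrix_vector_right_distrib matrix_vector_mult_scaleR AV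
            inner_add_left inner_add_right UU power2_eq_square)
      also have "\<dots> \<ge> (cos t)\<^sup>2 * S ! i + (sin t)\<^sup>2 * S ! i"
        using ge by (simp add: mult_left_mono)
      also have "(cos t)\<^sup>2 * S ! i + (sin t)\<^sup>2 * S ! i = S ! i"
        by (simp flip: distrib_right)
      finally show ?thesis using True l by (simp add: AV UU)
    qed
  qed
  then have "(norm (C t - A))\<^sup>2 \<le> (norm (B - A))\<^sup>2"
    using CC by (simp add: power2_norm_eq_inner inner_diff_left inner_diff_right inner_commute)
  then have "norm (C t - A) \<le> norm (B - A)" by (rule power2_le_imp_le) simp
  with t have "C t = B" by simp
  \<comment> \<open>The contradiction: \<open>B\<close> annihilates \<open>V j\<close>, whereas
    \<open>C t\<close> does not because \<open>sin t\<close> is positive.\<close>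
  have "B *v V j = 0"
    unfolding B svd_partial_sum_mult_vec using VV j \<open>r \<le> p\<close> by (intro sum.neutral) auto
  moreover have "C t *v V j = (S ! i * sin t) *\<^sub>R rotate_pair i j t U i"
  proof -
    have "C t *v V j = (\<Sum>l<r. if l = i then (S ! i * sin t) *\<^sub>R rotate_pair i j t U i else 0)"
      unfolding C_def svd_partial_sum_mult_vec using VV j i \<open>r \<le> p\<close>
      by (intro sum.cong) (auto simp: rotate_pair_def inner_add_left)
    then show ?thesis using i by simp
  qed
  moreover have "rotate_pair i j t U i \<noteq> 0"
    using orthonormal_uptoD[OF orth(1) i i] by (metis inner_zero_left zero_neq_one)
  ultimately show False
    using \<open>C t = B\<close> sin pos[of i] i \<open>r \<le> p\<close> by simp
qed

end

section \<open>Reduction of the regression problem to low-rank approximation\<close>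

lemma strict_local_min_on_pullback:
  assumes min: "strict_local_min_on S f w" and h: "continuous_on T h" "h ` T \<subseteq> S" "inj_on h T"
    and b: "b \<in> T" "h b = w" and g: "\<And>z. z \<in> T \<Longrightarrow> f (h b) < f (h z) \<Longrightarrow> g b < g z"
  shows "strict_local_min_on T g b"
proof -
  obtain U where U: "openin (top_of_set S) U" "w \<in> U" "\<And>z. z \<in> U \<Longrightarrow> z \<noteq> w \<Longrightarrow> f w < f z"
    using min unfolding strict_local_min_on_def by auto
  \<comment> \<open>The preimage of the neighbourhood of \<open>w\<close> serves for
    \<open>b\<close>; injectivity of \<open>h\<close> keeps points other than \<open>b\<close> away
    from \<open>w\<close>, which preserves strictness.\<close>
  have "openin (top_of_set T) (T \<inter> h -` U)"
    using h(1,2) U(1) by (intro continuous_openin_preimage[of T h S U]) auto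
  moreover have "g b < g z" if z: "z \<in> T" "h z \<in> U" "z \<noteq> b" for z
    using U(3)[of "h z"] z b h(3) g[of z] by (auto dest: inj_onD)
  ultimately show ?thesis
    unfolding strict_local_min_on_def using b U(2)
    by (intro conjI exI[of _ "T \<inter> h -` U"]) auto
qed

text \<open>\<open>X ** P\<close> and \<open>X ** Q\<close> are symmetric projections, and each
  absorbs the other on one side, so transposing identifies them; likewise \<open>P ** X\<close> and
  \<open>Q ** X\<close>. Then \<open>P = P X P = Q X P = Q X Q = Q\<close>.\<close>

lemma is_moore_penrose_unique:
  assumes "is_moore_penrose X P" "is_moore_penrose X Q"
  shows "P = Q"
proof -
  note P = assms(1)[unfolded is_moore_penrose_def] and Q = assms(2)[unfolded is_moore_penrose_def]
  have "X ** P = transpose ((X ** Q) ** (X ** P))"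
    using P Q by (simp add: matrix_mul_assoc)
  also have "\<dots> = (X ** P) ** (X ** Q)"
    using P Q by (simp add: matrix_transpose_mul[of "X ** Q"])
  also have "\<dots> = X ** Q"
    using P by (simp add: matrix_mul_assoc)
  finally have 1: "X ** P = X ** Q" .
  have "P ** X = transpose ((P ** X) ** (Q ** X))"
    using P Q by (metis matrix_mul_assoc)
  also have "\<dots> = (Q ** X) ** (P ** X)"
    using P Q by (simp add: matrix_transpose_mul[of "P ** X"])
  also have "\<dots> = Q ** X"
    using P by (metis matrix_mul_assoc)
  finally have 2: "P ** X = Q ** X" .
  have "P = P ** X ** P" using P by simp
  also have "\<dots> = Q ** (X ** P)" by (simp add: 2 matrix_mul_assoc)
  also have "\<dots> = Q" using Q by (simp add: 1 matrix_mul_assoc)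
  finally show ?thesis .
qed

text \<open>Full row rank makes \<open>X ** transpose X\<close> invertible, since its kernel is that
  of \<open>transpose X\<close>. The explicit right inverse built from it satisfies the Penrose
  equations, and uniqueness identifies it with \<open>pinv X\<close>.\<close>

lemma pinv_full_row_rank:
  fixes X :: "real^'n^'m"
  assumes "rank X = CARD('m)"
  shows "X ** pinv X = mat 1" "transpose (pinv X ** X) = pinv X ** X"
proof -
  let ?G = "X ** transpose X"
  have "x = 0" if "?G *v x = 0" for x
  proof -
    have "(x v* X) \<bullet> (x v* X) = x \<bullet> (?G *v x)"
      by (simp add: dot_lmul_matrix flip: matrix_vector_mul_assoc)
    then have "transpose X *v x = 0" using that by simp
    moreover have "inj ((*v) (transpose X))"
      using assms by (metis full_rank_injective rank_transpose)
    ultimately show "x = 0" by (metis injD matrix_vector_mult_0_right)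
  qed
  then obtain H where HG: "H ** ?G = mat 1" by (metis matrix_left_invertible_ker)
  then have GH: "?G ** H = mat 1" by (metis matrix_left_right_inverse)
  have "transpose H = transpose H ** (?G ** H)" by (simp add: GH)
  also have "\<dots> = transpose (?G ** H) ** H"
    by (simp add: matrix_transpose_mul transpose_transpose matrix_mul_assoc)
  finally have H: "transpose H = H" by (simp add: GH transpose_mat)
  define P where "P = transpose X ** H"
  have XP: "X ** P = mat 1" using GH by (simp add: P_def matrix_mul_assoc)
  have sym: "transpose (P ** X) = P ** X"
    by (simp add: P_def matrix_transpose_mul transpose_transpose H matrix_mul_assoc)
  have "is_moore_penrose X P"
    unfolding is_moore_penrose_def using XP sym
    by (simp add: transpose_mat matrix_mul_assoc[symmetric])
  then have "pinv X = P"
    unfolding pinv_def by (intro the_equality is_moore_penrose_unique)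
  with XP sym show "X ** pinv X = mat 1" "transpose (pinv X ** X) = pinv X ** X" by simp_all
qed

text \<open>Existence of a decomposition discharges both choice operators, so the truncation can be
  handled through concrete singular vectors.\<close>

lemma svd_truncation_eq:
  obtains u v where "is_svd A (singular_values A) u v"
    "svd_truncation r A
      = svd_partial_sum (min r (length (singular_values A))) (singular_values A) u v"
proof -
  have "\<exists>u v. is_svd A (singular_values A) u v"
    unfolding singular_values_def using is_svd_exists by (rule someI_ex)
  then have "\<exists>B u v. is_svd A (singular_values A) u v \<and>
      B = svd_partial_sum (min r (length (singular_values A))) (singular_values A) u v"
    by blast
  from someI_ex[OF this] show ?thesis
    unfolding svd_truncation_def[symmetric] using that by blast
qed

text \<open>Pythagoras: right multiplication by the symmetric idempotent \<open>pinv X ** X\<close>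
  fixes \<open>W ** X - A\<close> and annihilates \<open>A - Y\<close>, so the two are orthogonal.
  Thus \<open>F0\<close> orders matrices by the distance of \<open>W ** X\<close> from
  \<open>A\<close>.\<close>

lemma F0_decomposition:
  fixes X :: "real^'n^'m" and Y :: "real^'n^'k"
  assumes "rank X = CARD('m)"
  defines "A \<equiv> Y ** pinv X ** X"
  shows "F0 X Y W = 1/2 * (norm (W ** X - A))\<^sup>2 + 1/2 * (norm (A - Y))\<^sup>2"
proof -
  let ?K = "pinv X ** X" and ?D = "W ** X - A"
  have "X ** ?K = X" using pinv_full_row_rank[OF assms(1)] by (simp add: matrix_mul_assoc)
  then have KK: "?K ** ?K = ?K" by (metis matrix_mul_assoc)
  have "?D ** ?K = ?D"
    unfolding A_def diff_matrix_mult using \<open>X ** ?K = X\<close> by (metis matrix_mul_assoc)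
  then have "?D \<bullet> (A - Y) = ?D \<bullet> ((A - Y) ** ?K)"
    using inner_mult_right_transpose[of ?D ?K "A - Y"] pinv_full_row_rank[OF assms(1)] by simp
  also have "(A - Y) ** ?K = 0"
    unfolding A_def diff_matrix_mult using KK by (simp add: matrix_mul_assoc[symmetric])
  finally have "?D \<bullet> (A - Y) = 0" by simp
  moreover have "W ** X - Y = ?D + (A - Y)" by simp
  ultimately have "(norm (W ** X - Y))\<^sup>2 = (norm ?D)\<^sup>2 + (norm (A - Y))\<^sup>2"
    by (simp only: power2_norm_eq_inner inner_add_left inner_add_right inner_commute)
  then show ?thesis by (simp add: F0_def)
qed

text \<open>Because \<open>singular_values\<close> lists only positive values, the bound of
  \<open>r\<close> by the rank of \<open>Y ** pinv X ** X\<close> guarantees that the truncation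
  really has \<open>r\<close> components. Below that rank bound the truncation would be the whole
  matrix, and the solution would fall outside \<open>rank_manifold r\<close>.\<close>

theorem theorem14:
  fixes X :: "real^'n^'m" and Y :: "real^'n^'k" and r :: nat
  assumes "rank X = CARD('m)"
    and "distinct (singular_values (Y ** pinv X ** X))"
    and "1 < r" and "r \<le> min CARD('k) CARD('m)"
    and "r \<le> rank (Y ** pinv X ** X)"
  shows "\<forall>W. strict_local_min_on (rank_manifold r) (F0 X Y) W \<longleftrightarrow> W = rrr_solution r X Y"
proof -
  define P where "P = pinv X"
  define A where "A = Y ** P ** X"
  have XP: "X ** P = mat 1" using pinv_full_row_rank[OF assms(1)] by (simp add: P_def)
  have XPX: "X ** (P ** X) = X" using XP by (simp add: matrix_mul_assoc)
  then have AK: "A ** (P ** X) = A" unfolding A_def by (metis matrix_mul_assoc)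
  have F0: "F0 X Y W < F0 X Y W' \<longleftrightarrow> norm (W ** X - A) < norm (W' ** X - A)" for W W'
    unfolding F0_decomposition[OF assms(1)] A_def P_def
    by (simp flip: not_le)
  have WXP: "W ** X ** P = W" for W :: "real^'m^'k"
    using XP by (simp flip: matrix_mul_assoc)
  have rankX: "rank (W ** X) = rank W" for W :: "real^'m^'k"
    by (rule antisym) (metis rank_mul_le_left WXP)+
  let ?s = "singular_values A"
  obtain u v where svd: "is_svd A ?s u v"
    and trunc: "svd_truncation r A = svd_partial_sum (min r (length ?s)) ?s u v"
    by (rule svd_truncation_eq)
  have len: "r \<le> length ?s"
    using assms(5) is_svd_rank[OF svd] by (simp add: A_def P_def)
  note svd = is_svdD[OF svd]
  define B where "B = svd_partial_sum r ?s u v"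
  have rrr: "rrr_solution r X Y = B ** P"
    unfolding rrr_solution_def using trunc len by (simp add: B_def A_def P_def)
  have gap: "?s ! j < ?s ! i" if "i < r" "r \<le> j" "j < length ?s" for i j
    using svd(5)[of i j] that assms(2)
    by (auto simp: order.order_iff_strict nth_eq_iff_index_eq A_def P_def)
  have orth_r: "orthonormal_upto r u" "orthonormal_upto r v"
    using svd(1,2) len by (auto simp: orthonormal_upto_def)
  have rankB: "rank B = r"
    unfolding B_def using svd(4) len by (intro rank_svd_partial_sum orth_r) auto
  have best: "M = B" if "rank M = r" "norm (M - A) \<le> norm (B - A)" for M
    using eckart_young_unique[OF svd(1-3) len svd(4) gap that(1)] that(2) by (simp add: B_def)
  have BK: "B ** (P ** X) = B"
  proof -
    have "v l v* (P ** X) = v l" if "l < length ?s" for l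
    proof -
      have "(?s ! l *\<^sub>R v l) v* (P ** X) = ?s ! l *\<^sub>R v l"
        using svd(7)[OF that] AK by (metis vector_matrix_mul_assoc)
      then show ?thesis using svd(4)[OF that] by (simp add: scaleR_vector_matrix_assoc)
    qed
    then show ?thesis
      unfolding B_def svd_partial_sum_mult_matrix using len by (intro svd_partial_sum_cong) auto
  qed
  have "strict_local_min_on (rank_manifold r) (F0 X Y) (B ** P)"
    unfolding strict_local_min_on_def
  proof (intro conjI exI ballI)
    show "B ** P \<in> rank_manifold r"
      using rankX[of "B ** P"] rankB BK by (simp add: rank_manifold_def matrix_mul_assoc)
    \<comment> \<open>The neighbourhood is the whole manifold, since the minimum is global.\<close>
    show "B ** P \<in> rank_manifold r" by fact
    fix W assume W: "W \<in> rank_manifold r - {B ** P}"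
    then have "W ** X \<noteq> B" using WXP by auto
    then have "norm (B - A) < norm (W ** X - A)"
      using best[of "W ** X"] W by (force simp: rank_manifold_def rankX)
    then show "F0 X Y (B ** P) < F0 X Y W"
      using BK by (simp add: F0 matrix_mul_assoc)
  qed simp
  moreover have "W = B ** P" if "strict_local_min_on (rank_manifold r) (F0 X Y) W" for W
  proof -
    \<comment> \<open>\<open>?T\<close> is the image of the manifold under
      \<open>W \<mapsto> W ** X\<close>, with inverse \<open>M \<mapsto> M ** P\<close>; the local
      minimum is pulled back along this inverse.\<close>
    let ?T = "{M :: real^'n^'k. rank M = r \<and> M ** (P ** X) = M}"
    have "W \<in> rank_manifold r" using that by (simp add: strict_local_min_on_def)
    have min: "strict_local_min_on ?T (\<lambda>M. norm (M - A)) (W ** X)"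
    proof (rule strict_local_min_on_pullback[OF that, of ?T "\<lambda>M. M ** P"])
      show "continuous_on ?T (\<lambda>M. M ** P)"
        by (intro linear_continuous_on linear_conv_bounded_linear[THEN iffD1] linear_matrix_mult_right)
      show "(\<lambda>M. M ** P) ` ?T \<subseteq> rank_manifold r"
        using rankX by (auto simp: rank_manifold_def matrix_mul_assoc) (metis matrix_mul_assoc rankX)
      show "inj_on (\<lambda>M. M ** P) ?T"
        by (rule inj_onI) (metis (mono_tags, lifting) matrix_mul_assoc mem_Collect_eq)
      show "W ** X \<in> ?T"
        using \<open>W \<in> rank_manifold r\<close> XPX by (simp add: rank_manifold_def rankX flip: matrix_mul_assoc)
      show "W ** X ** P = W" by (rule WXP)
      show "norm (W ** X - A) < norm (M - A)"
        if "M \<in> ?T" "F0 X Y (W ** X ** P) < F0 X Y (M ** P)" for M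
        using that by (simp add: F0 WXP flip: matrix_mul_assoc[of M])
    qed
    obtain p U V S where SUV: "orthonormal_upto p U" "orthonormal_upto p V" "A = svd_partial_sum p S U V"
      "W ** X = svd_partial_sum r S U V" "r \<le> p" "\<And>l. l < p \<Longrightarrow> 0 < S ! l"
      by (rule min_is_partial_svd[OF AK min]) (rule that)
    have "W ** X = B"
    \<comment> \<open>Both \<open>W ** X\<close> and \<open>B\<close> are truncations, with a gap,
      of decompositions of \<open>A\<close>. Uniqueness is applied to the decomposition of whichever
      is not closer to \<open>A\<close>, with the other as competitor, so their errors need not be
      computed.\<close>
    proof (cases "norm (W ** X - A) \<le> norm (B - A)")
      case True
      then show ?thesis using best \<open>W \<in> rank_manifold r\<close> by (simp add: rank_manifold_def rankX)
    next
      case False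
      then have "norm (B - A) \<le> norm (svd_partial_sum r S U V - A)" using SUV(4) by simp
      then have "B = svd_partial_sum r S U V"
        by (intro eckart_young_unique[OF SUV(1-3,5,6) min_gap[OF AK min SUV] rankB])
      then show ?thesis using SUV(4) by simp
    qed
    then show ?thesis using WXP by metis
  qed
  ultimately show ?thesis unfolding rrr by blast
qed

end
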